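(* Suppose the data vectors $\mathbf X_i\in\mathbb C^K$ are uncorrelated, that is, $E\{\mathbf X_i\mathbf X_i^H\}=\mathbf I_K$ and $E\{\mathbf X_{i-1}\mathbf X_i^H\}=\mathbf 0_{K\times K}$. Let $\mathbf y_i$ be the OFDM symbol vector and, for $i>0$, $\mathbf w_i$ the TD-NC-OFDM smooth signal vector of maximum derivative order $V$, both defined in the context. Then the average power of the OFDM symbol vector and the average power of the smooth signal are $$E\{\mathbf y_i^H\mathbf y_i\}=\frac KN,\qquad E\{\mathbf w_i^H\mathbf w_i\}=\frac{2(V+1)}{N},$$ so the power ratio between the transmit signal and the smooth signal is $$\frac{E\{\mathbf y_i^H\mathbf y_i\}}{E\{\mathbf w_i^H\mathbf w_i\}}=\frac{K}{2(V+1)}.$$ Consequently, in the multipath channel described in the context, with the length of the cyclic prefix longer than or equal to the maximum channel time delay, the received signal-to-interference-plus-noise ratio $$\gamma_{SINR}=\frac{\sum_{\tilde l=1}^{\tilde L}|h_{\tilde l}|^2\,E\{\mathbf y_i^H\mathbf y_i\}}{\sigma_n^2+\sum_{\tilde l=1}^{\tilde L}|h_{\tilde l}|^2\,E\{\mathbf w_i^H\mathbf w_i\}}$$ equals $$\gamma_{SINR}=\frac{K/N}{\dfrac{\sigma_n^2}{\sum_{\tilde l=1}^{\tilde L}|h_{\tilde l}|^2}+\dfrac{2(V+1)}{N}}.$$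
   Context: Notation: $j$ is the imaginary unit, $0^0=1$, $(\cdot)^T$ is the transpose and $(\cdot)^H$ the conjugate transpose. $K$ is the number of subcarriers, with index set $\{k_0,\dots,k_{K-1}\}=\{-\frac K2,\dots,\frac K2-1\}$; $N$ is the number of samples of an OFDM symbol without cyclic prefix (CP); $N_{cp}$ is the CP length in samples; $V$ is the maximum derivative order; $\varphi=-2\pi N_{cp}/N$. The $i$-th data vector ($i=0,1,2,\dots$) is $\mathbf X_i=[X_{i,k_0},\dots,X_{i,k_{K-1}}]^T$. Matrices. $\mathbf F_f$ is the $K\times N$ Fourier transform matrix with entries $\{\mathbf F_f\}_{m+1,n+1}=e^{-j2\pi k_m n/N}$, $0\le m\le K-1$, $0\le n\le N-1$; it satisfies $\frac1N\mathbf F_f\mathbf F_f^H=\mathbf I_K$. Put $\mathbf\Phi=\mathrm{diag}(e^{j\varphi k_0},\dots,e^{j\varphi k_{K-1}})$. $\mathbf B_2$ is the $(V+1)\times K$ matrix with $\{\mathbf B_2\}_{v+1,m+1}=(j\frac{2\pi}{N}k_m)^v$, $0\le v\le V$, and $\mathbf B_1=\mathbf\Phi^H\mathbf B_2^T$. Put $$\mathbf Q_f=\tfrac1N\mathbf F_f^H\mathbf B_1,\quad \mathbf P_1=\tfrac1N\mathbf B_2\mathbf F_f,\quad \mathbf P_2=\tfrac1N\mathbf B_2\mathbf\Phi,\quad \mathbf P_f=\tfrac1N\mathbf B_2\mathbf B_2^T,$$ where the $(V+1)\times(V+1)$ matrix $\mathbf P_f$ has linearly independent rows and columns, so $\mathbf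 P_f^{-1}$ exists. (The columns of $\mathbf Q_f$ are samples of the function $f(n)=\frac1N\sum_{m}e^{-j\varphi k_m}e^{j2\pi k_m n/N}$ and of its first $V$ derivatives, and $\{\mathbf P_f\}_{u+1,v+1}=f^{(u+v)}(-N_{cp})$.) TD-NC-OFDM. The OFDM symbol vector is $\mathbf y_i=\frac1N\mathbf F_f^H\mathbf X_i$. The smoothed symbols are $\overline{\mathbf y}_0=\mathbf y_0$ and, for $i>0$, $\overline{\mathbf y}_i=\mathbf y_i+\mathbf w_i$, where the smooth signal is $\mathbf w_i=\mathbf Q_f\mathbf b_i$ with $\mathbf b_i=\mathbf P_f^{-1}(\mathbf P_1\overline{\mathbf y}_{i-1}-\mathbf P_2\mathbf X_i)$. This choice makes the value and the first $V$ derivatives of the $i$-th smoothed symbol at $n=-N_{cp}$ agree with those of the $(i-1)$-th smoothed symbol at $n=N$. Channel. The $i$-th received time-domain symbol is $r_i(t)=\sum_{\tilde l=1}^{\tilde L}h_{\tilde l}\,\overline y_i(t-\tau_{\tilde l})+n_i(t)$, where $\overline y_i(t)$ is the smoothed symbol, $h_{\tilde l}$ and $\tau_{\tilde l}$ are the coefficient and the time delay of the $\tilde l$-th path, and $n_i(t)$ is additive white Gaussian noise with zero mean and variance $\sigma_n^2$.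
   Formalization: "Uncorrelated" is taken as E{X_l X_i^H}=0 for all l≠i, not only l=i-1: with adjacent vectors only the claim fails for i≥2 (V=0, N_cp=0, X_2=X_0 gives w_2=0). *)

theory Defs
  imports
    "HOL-Probability.Probability"
    "Jordan_Normal_Form.Gauss_Jordan_Elimination"
    "Jordan_Normal_Form.Schur_Decomposition"
begin

unbundle no vec_syntax
unbundle no inner_syntax

section \<open>TD-NC-OFDM\<close>

text \<open>All matrices are indexed from 0.  Throughout, \<open>K\<close> (even) is the number of subcarriers, \<open>N\<close> the
  number of samples of an OFDM symbol without cyclic prefix, \<open>Ncp\<close> the length of the cyclic prefix
  in samples and \<open>V\<close> the maximum derivative order.  Time is measured in samples.\<close>

definition subcarrier :: "nat \<Rightarrow> nat \<Rightarrow> int" where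
  "subcarrier K m = int m - int (K div 2)"

definition cp_phase :: "nat \<Rightarrow> nat \<Rightarrow> real" where
  "cp_phase N Ncp = - 2 * pi * real Ncp / real N"

definition Fourier_mat :: "nat \<Rightarrow> nat \<Rightarrow> complex mat" where
  "Fourier_mat K N =
     mat K N (\<lambda>(m, n). exp (- \<i> * 2 * of_real pi * of_int (subcarrier K m) * of_nat n / of_nat N))"

definition Phi_mat :: "nat \<Rightarrow> nat \<Rightarrow> nat \<Rightarrow> complex mat" where
  "Phi_mat K N Ncp =
     mat_diag K (\<lambda>m. exp (\<i> * of_real (cp_phase N Ncp) * of_int (subcarrier K m)))"

definition B2_mat :: "nat \<Rightarrow> nat \<Rightarrow> nat \<Rightarrow> complex mat" where
  "B2_mat K N V =
     mat (V + 1) K (\<lambda>(v, m). (\<i> * (2 * of_real pi / of_nat N) * of_int (subcarrier K m)) ^ v)"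

definition B1_mat :: "nat \<Rightarrow> nat \<Rightarrow> nat \<Rightarrow> nat \<Rightarrow> complex mat" where
  "B1_mat K N Ncp V = mat_adjoint (Phi_mat K N Ncp) * transpose_mat (B2_mat K N V)"

definition Qf_mat :: "nat \<Rightarrow> nat \<Rightarrow> nat \<Rightarrow> nat \<Rightarrow> complex mat" where
  "Qf_mat K N Ncp V = (1 / of_nat N) \<cdot>\<^sub>m (mat_adjoint (Fourier_mat K N) * B1_mat K N Ncp V)"

definition P1_mat :: "nat \<Rightarrow> nat \<Rightarrow> nat \<Rightarrow> complex mat" where
  "P1_mat K N V = (1 / of_nat N) \<cdot>\<^sub>m (B2_mat K N V * Fourier_mat K N)"

definition P2_mat :: "nat \<Rightarrow> nat \<Rightarrow> nat \<Rightarrow> nat \<Rightarrow> complex mat" where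
  "P2_mat K N Ncp V = (1 / of_nat N) \<cdot>\<^sub>m (B2_mat K N V * Phi_mat K N Ncp)"

definition Pf_mat :: "nat \<Rightarrow> nat \<Rightarrow> nat \<Rightarrow> complex mat" where
  "Pf_mat K N V = (1 / of_nat N) \<cdot>\<^sub>m (B2_mat K N V * transpose_mat (B2_mat K N V))"

text \<open>\<open>mat_inverse\<close> returns \<open>None\<close> on singular matrices.  \<open>Pf_mat K N V\<close> is nonsingular as soon as
  \<open>V + 1 \<le> K\<close> and \<open>0 < N\<close> (a Gram matrix of Vandermonde type with \<open>K\<close> distinct nodes), and
  singular if \<open>K < V + 1\<close>.\<close>

definition Pf_inv :: "nat \<Rightarrow> nat \<Rightarrow> nat \<Rightarrow> complex mat" where
  "Pf_inv K N V = the (mat_inverse (Pf_mat K N V))"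

text \<open>The sequence \<open>x\<close> below is one realisation of the data vectors.\<close>

definition ofdm_symbol :: "nat \<Rightarrow> nat \<Rightarrow> complex vec \<Rightarrow> complex vec" where
  "ofdm_symbol K N a = (1 / of_nat N) \<cdot>\<^sub>v (mat_adjoint (Fourier_mat K N) *\<^sub>v a)"

definition smooth_coeff ::
  "nat \<Rightarrow> nat \<Rightarrow> nat \<Rightarrow> nat \<Rightarrow> complex vec \<Rightarrow> complex vec \<Rightarrow> complex vec" where
  "smooth_coeff K N Ncp V yprev a =
     Pf_inv K N V *\<^sub>v (P1_mat K N V *\<^sub>v yprev - P2_mat K N Ncp V *\<^sub>v a)"

primrec smoothed_symbol ::
  "nat \<Rightarrow> nat \<Rightarrow> nat \<Rightarrow> nat \<Rightarrow> (nat \<Rightarrow> complex vec) \<Rightarrow> nat \<Rightarrow> complex vec" where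
  "smoothed_symbol K N Ncp V x 0 = ofdm_symbol K N (x 0)"
| "smoothed_symbol K N Ncp V x (Suc i) =
     ofdm_symbol K N (x (Suc i)) +
     Qf_mat K N Ncp V *\<^sub>v smooth_coeff K N Ncp V (smoothed_symbol K N Ncp V x i) (x (Suc i))"

text \<open>\<open>b_vec\<close> and \<open>smooth_signal\<close> (the vectors $\mathbf{b}_i$ and $\mathbf{w}_i$) are meaningful for
  \<open>i > 0\<close> only; then
  \<open>smoothed_symbol K N Ncp V x i = ofdm_symbol K N (x i) + smooth_signal K N Ncp V x i\<close>.\<close>

definition b_vec ::
  "nat \<Rightarrow> nat \<Rightarrow> nat \<Rightarrow> nat \<Rightarrow> (nat \<Rightarrow> complex vec) \<Rightarrow> nat \<Rightarrow> complex vec" where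
  "b_vec K N Ncp V x i = smooth_coeff K N Ncp V (smoothed_symbol K N Ncp V x (i - 1)) (x i)"

definition smooth_signal ::
  "nat \<Rightarrow> nat \<Rightarrow> nat \<Rightarrow> nat \<Rightarrow> (nat \<Rightarrow> complex vec) \<Rightarrow> nat \<Rightarrow> complex vec" where
  "smooth_signal K N Ncp V x i = Qf_mat K N Ncp V *\<^sub>v b_vec K N Ncp V x i"

text \<open>The smoothed symbol as a function of continuous time.  Its subcarrier amplitudes are those of
  $\mathbf{X}_i + \mathbf{B}_1 \mathbf{b}_i$ because $\mathbf{Q}_f = \frac1N \mathbf{F}_f^H \mathbf{B}_1$; the samples
  at \<open>0, \<dots>, N - 1\<close> are the entries of \<open>smoothed_symbol K N Ncp V x i\<close>.\<close>

definition smoothed_spectrum ::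
  "nat \<Rightarrow> nat \<Rightarrow> nat \<Rightarrow> nat \<Rightarrow> (nat \<Rightarrow> complex vec) \<Rightarrow> nat \<Rightarrow> complex vec" where
  "smoothed_spectrum K N Ncp V x i =
     (if i = 0 then x 0 else x i + B1_mat K N Ncp V *\<^sub>v b_vec K N Ncp V x i)"

definition smoothed_waveform ::
  "nat \<Rightarrow> nat \<Rightarrow> nat \<Rightarrow> nat \<Rightarrow> (nat \<Rightarrow> complex vec) \<Rightarrow> nat \<Rightarrow> real \<Rightarrow> complex" where
  "smoothed_waveform K N Ncp V x i t =
     1 / of_nat N * (\<Sum>m<K. smoothed_spectrum K N Ncp V x i $ m *
       exp (\<i> * 2 * of_real pi * of_int (subcarrier K m) * of_real t / of_nat N))"

section \<open>Second moments of random vectors\<close>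

definition random_vec :: "'w measure \<Rightarrow> nat \<Rightarrow> ('w \<Rightarrow> complex vec) \<Rightarrow> bool" where
  "random_vec M d X \<longleftrightarrow> (\<forall>\<omega>. X \<omega> \<in> carrier_vec d) \<and>
     (\<forall>m<d. (\<lambda>\<omega>. X \<omega> $ m) \<in> borel_measurable M)"

text \<open>$E\{\mathbf{X}\mathbf{Y}^H\}$, entry by entry\<close>

definition cross_corr ::
  "'w measure \<Rightarrow> nat \<Rightarrow> ('w \<Rightarrow> complex vec) \<Rightarrow> ('w \<Rightarrow> complex vec) \<Rightarrow> complex mat" where
  "cross_corr M d X Y = mat d d (\<lambda>(m, n). (\<integral>\<omega>. X \<omega> $ m * cnj (Y \<omega> $ n) \<partial>M))"

text \<open>Data vectors are uncorrelated when any two different ones are, not merely neighbouring ones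
  (the recursion for the smoothed symbols carries the whole past along).
  Square integrability need not be assumed: the diagonal entries of \<open>1\<^sub>m K\<close> are nonzero, while the
  Bochner integral of a non-integrable function is 0.\<close>

definition uncorrelated_data :: "'w measure \<Rightarrow> nat \<Rightarrow> (nat \<Rightarrow> 'w \<Rightarrow> complex vec) \<Rightarrow> bool" where
  "uncorrelated_data M K X \<longleftrightarrow>
     (\<forall>i. random_vec M K (X i)) \<and>
     (\<forall>i. cross_corr M K (X i) (X i) = 1\<^sub>m K) \<and>
     (\<forall>l i. l \<noteq> i \<longrightarrow> cross_corr M K (X l) (X i) = 0\<^sub>m K K)"

text \<open>$E\{\mathbf{v}^H\mathbf{v}\}$\<close>

definition avg_power :: "'w measure \<Rightarrow> ('w \<Rightarrow> complex vec) \<Rightarrow> complex" where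
  "avg_power M v = (\<integral>\<omega>. conjugate (v \<omega>) \<bullet> v \<omega> \<partial>M)"

section \<open>Multipath channel\<close>

text \<open>Complex baseband white Gaussian noise of variance \<open>s2\<close> on the observation window of every
  symbol: circularly symmetric, that is, real and imaginary parts are independent, centred and have
  variance \<open>s2 / 2\<close> each.\<close>

definition awgn :: "'w measure \<Rightarrow> nat \<Rightarrow> real \<Rightarrow> (nat \<Rightarrow> real \<Rightarrow> 'w \<Rightarrow> complex) \<Rightarrow> bool" where
  "awgn M N s2 n \<longleftrightarrow> 0 < s2 \<and>
     (\<forall>i. \<forall>t\<in>{0..<real N}.
        distributed M lborel (\<lambda>\<omega>. Re (n i t \<omega>)) (normal_density 0 (sqrt (s2 / 2))) \<and>
        distributed M lborel (\<lambda>\<omega>. Im (n i t \<omega>)) (normal_density 0 (sqrt (s2 / 2)))) \<and>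
     prob_space.indep_vars M (\<lambda>_. borel)
       (\<lambda>(i, t, re) \<omega>. if re then Re (n i t \<omega>) else Im (n i t \<omega>))
       (UNIV \<times> {0..<real N} \<times> (UNIV :: bool set))"

text \<open>Paths \<open>1, \<dots>, L\<close> with coefficients \<open>h\<close> and delays \<open>tau\<close> (in samples).  The equation for the
  received symbol \<open>r\<close> is imposed on the window that is left after removal of the cyclic prefix; for
  delays up to \<open>Ncp\<close> no other symbol reaches into it.  Some path must be present, since the SINR
  formula divides by the total path gain.\<close>

definition multipath_channel ::
  "'w measure \<Rightarrow> nat \<Rightarrow> nat \<Rightarrow> nat \<Rightarrow> nat \<Rightarrow> (nat \<Rightarrow> 'w \<Rightarrow> complex vec) \<Rightarrow>
   nat \<Rightarrow> (nat \<Rightarrow> complex) \<Rightarrow> (nat \<Rightarrow> real) \<Rightarrow> real \<Rightarrow>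
   (nat \<Rightarrow> real \<Rightarrow> 'w \<Rightarrow> complex) \<Rightarrow> (nat \<Rightarrow> real \<Rightarrow> 'w \<Rightarrow> complex) \<Rightarrow> bool" where
  "multipath_channel M K N Ncp V X L h tau s2 n r \<longleftrightarrow>
     (\<exists>l\<in>{1..L}. h l \<noteq> 0) \<and> (\<forall>l\<in>{1..L}. 0 \<le> tau l) \<and> awgn M N s2 n \<and>
     (\<forall>i. \<forall>t\<in>{0..<real N}. \<forall>\<omega>. r i t \<omega> =
        (\<Sum>l=1..L. h l * smoothed_waveform K N Ncp V (\<lambda>k. X k \<omega>) i (t - tau l)) + n i t \<omega>)"

definition sinr ::
  "'w measure \<Rightarrow> nat \<Rightarrow> (nat \<Rightarrow> complex) \<Rightarrow> real \<Rightarrow>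
   ('w \<Rightarrow> complex vec) \<Rightarrow> ('w \<Rightarrow> complex vec) \<Rightarrow> complex" where
  "sinr M L h s2 y w =
     (\<Sum>l=1..L. of_real ((cmod (h l))\<^sup>2) * avg_power M y) /
     (of_real s2 + (\<Sum>l=1..L. of_real ((cmod (h l))\<^sup>2) * avg_power M w))"

end

(* With S = diag((-1)^v), the complex conjugate of B2 is S B2, so G = B2^T (B2 B2^T)^-1 B2 is a
   Hermitian projection, of trace V + 1.  In the frequency domain the smoothed symbols A_i satisfy
     A_i = Phi^H G A_(i-1) + (I - J) X_i,   where J = Phi^H G Phi,
   and the smooth signal is Phi^H G A_(i-1) - J X_i.  As A_(i-1) depends on X_0, ..., X_(i-1) only,
   it is uncorrelated with X_i; since (Phi^H G)(Phi^H G)^H = J is again a projection,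
   E{A_i A_i^H} = J + (I - J) = I by induction.  Hence the smooth signal has covariance 2J, of trace
   2(V + 1), and Parseval's identity F_f F_f^H = N I supplies the factor 1/N. *)
theory Submission
  imports Defs
begin

text \<open>The obstacle is that \<open>Pf_mat\<close> pairs \<open>B2_mat\<close> with its
  transpose and not with its adjoint, so neither its invertibility nor the symmetry of the
  projection G is automatic for complex entries. Both come from the nodes being purely imaginary:
  transpose and adjoint then differ only by signs. Invertibility also needs V + 1 \<le> K, since a
  nonzero polynomial of degree at most V has too few roots to vanish at all K subcarriers.

  The smooth signal has spectrum Phi^H G (A_(i-1) - Phi X_i). The bracket is the mismatch between
  the end of the previous symbol and the start of the current one, and G keeps exactly the part of
  it that the value and the first V derivatives can see, because G and B2 have the same kernel. The
  two ends are uncorrelated and each contributes V + 1 to the trace, whence the factor 2.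

  Every smoothed symbol depends on the whole past, but that past enters the powers only through the
  covariance of A_(i-1). Whiteness of A_i is therefore the right invariant.\<close>

section \<open>Adjoints, Hermitian products and traces of complex matrices\<close>

lemma mat_adjoint_dim [simp]:
  "dim_row (mat_adjoint A) = dim_col A" "dim_col (mat_adjoint A) = dim_row A"
  unfolding mat_adjoint_def by auto

lemma mat_adjoint_carrier [simp]:
  "A \<in> carrier_mat n m \<Longrightarrow> mat_adjoint A \<in> carrier_mat m n"
  by (auto intro: carrier_matI)

lemma index_mat_adjoint [simp]:
  "i < dim_col A \<Longrightarrow> j < dim_row A \<Longrightarrow> mat_adjoint A $$ (i, j) = conjugate (A $$ (j, i))"
  unfolding mat_adjoint_def by (simp add: mat_of_rows_def)

lemma mat_adjoint_mat_adjoint [simp]: "mat_adjoint (mat_adjoint A) = A"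
  by (intro eq_matI) auto

lemma mat_adjoint_one [simp]: "mat_adjoint (1\<^sub>m n :: complex mat) = 1\<^sub>m n"
  by (intro eq_matI) auto

lemma mat_adjoint_mult:
  fixes A B :: "complex mat"
  assumes "A \<in> carrier_mat n m" "B \<in> carrier_mat m k"
  shows "mat_adjoint (A * B) = mat_adjoint B * mat_adjoint A"
  using assms by (intro eq_matI) (auto simp: scalar_prod_def mult.commute)

lemma mat_adjoint_smult:
  "mat_adjoint (c \<cdot>\<^sub>m A) = cnj c \<cdot>\<^sub>m mat_adjoint (A :: complex mat)"
  by (intro eq_matI) auto

lemma mat_adjoint_uminus:
  "mat_adjoint (- A) = - mat_adjoint (A :: complex mat)"
  by (intro eq_matI) auto

lemma mat_adjoint_minus:
  fixes A B :: "complex mat"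
  assumes "A \<in> carrier_mat n m" "B \<in> carrier_mat n m"
  shows "mat_adjoint (A - B) = mat_adjoint A - mat_adjoint B"
  using assms by (intro eq_matI) auto

text \<open>Serves both the kernel argument for \<open>Pf_mat\<close> and Parseval's
  identity.\<close>

lemma conjugate_scalar_prod_mult_mat_vec:
  fixes A :: "complex mat"
  assumes A: "A \<in> carrier_mat n m" and u: "u \<in> carrier_vec n" and v: "v \<in> carrier_vec m"
  shows "conjugate u \<bullet> (A *\<^sub>v v) = conjugate (mat_adjoint A *\<^sub>v u) \<bullet> v"
proof -
  have "conjugate u \<bullet> (A *\<^sub>v v) = (\<Sum>i<n. \<Sum>j<m. cnj (u $ i) * (A $$ (i, j) * v $ j))"
    using assms by (auto simp: scalar_prod_def sum_distrib_left lessThan_atLeast0)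
  also have "\<dots> = (\<Sum>j<m. \<Sum>i<n. cnj (u $ i) * (A $$ (i, j) * v $ j))"
    by (rule sum.swap)
  also have "\<dots> = conjugate (mat_adjoint A *\<^sub>v u) \<bullet> v"
    using assms by (auto simp: scalar_prod_def sum_distrib_right sum_distrib_left lessThan_atLeast0
        mult_ac intro!: sum.cong)
  finally show ?thesis .
qed

text \<open>Definiteness holds for the Hermitian product only: over the complex numbers the bilinear
  \<open>u \<bullet> u\<close> can vanish for nonzero \<open>u\<close>.\<close>

lemma conjugate_scalar_prod_self_eq_0D:
  fixes u :: "complex vec"
  assumes "conjugate u \<bullet> u = 0" "u \<in> carrier_vec n"
  shows "u = 0\<^sub>v n"
proof -
  have "complex_of_real (\<Sum>i<n. (cmod (u $ i))\<^sup>2) = conjugate u \<bullet> u"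
    using assms(2) by (auto simp: scalar_prod_def lessThan_atLeast0 complex_norm_square
        mult.commute simp del: of_real_power)
  then have "(\<Sum>i<n. (cmod (u $ i))\<^sup>2) = 0"
    using assms(1) by (metis of_real_eq_0_iff)
  then have "\<forall>i<n. u $ i = 0"
    by (auto simp: sum_nonneg_eq_0_iff)
  with assms(2) show ?thesis
    by (intro eq_vecI) auto
qed

lemma smult_mat_mult_vec:
  "(k \<cdot>\<^sub>m A) *\<^sub>v v = k \<cdot>\<^sub>v (A *\<^sub>v v)"
  if "A \<in> carrier_mat n m" "v \<in> carrier_vec m" for A :: "'a :: comm_semiring_0 mat"
  using that by (intro eq_vecI) (auto simp: scalar_prod_def sum_distrib_left mult_ac)

lemma mult_mat_vec_zero: "A *\<^sub>v 0\<^sub>v m = 0\<^sub>v n"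
  if "A \<in> carrier_mat n m" for A :: "'a :: semiring_0 mat"
  using that by (intro eq_vecI) auto

lemma smult_smult_mat: "a \<cdot>\<^sub>m (b \<cdot>\<^sub>m A) = (a * b) \<cdot>\<^sub>m A" for A :: "'a :: semigroup_mult mat"
  by (intro eq_matI) (auto simp: mult.assoc)

lemma one_smult_mat: "1 \<cdot>\<^sub>m A = A" for A :: "'a :: monoid_mult mat"
  by (intro eq_matI) auto

definition mat_trace :: "'a :: comm_monoid_add mat \<Rightarrow> 'a" where
  "mat_trace A = (\<Sum>i<dim_row A. A $$ (i, i))"

lemma mat_trace_comm:
  fixes A B :: "'a :: comm_semiring_0 mat"
  assumes "A \<in> carrier_mat n m" "B \<in> carrier_mat m n"
  shows "mat_trace (A * B) = mat_trace (B * A)"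
proof -
  have "mat_trace (A * B) = (\<Sum>i<n. \<Sum>j<m. A $$ (i, j) * B $$ (j, i))"
    using assms by (auto simp: mat_trace_def scalar_prod_def lessThan_atLeast0)
  also have "\<dots> = (\<Sum>j<m. \<Sum>i<n. B $$ (j, i) * A $$ (i, j))"
    by (subst sum.swap) (simp add: mult.commute)
  also have "\<dots> = mat_trace (B * A)"
    using assms by (auto simp: mat_trace_def scalar_prod_def lessThan_atLeast0)
  finally show ?thesis .
qed

lemma mat_trace_add:
  assumes "A \<in> carrier_mat n n" "B \<in> carrier_mat n n"
  shows "mat_trace (A + B) = mat_trace A + mat_trace B"
  using assms by (auto simp: mat_trace_def sum.distrib)

lemma mat_trace_one: "mat_trace (1\<^sub>m n :: 'a :: semiring_1 mat) = of_nat n"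
  by (simp add: mat_trace_def)

lemma mat_trace_smult:
  "mat_trace (c \<cdot>\<^sub>m A) = c * mat_trace (A :: 'a :: semiring_0 mat)" if "A \<in> carrier_mat n n"
  using that by (auto simp: mat_trace_def sum_distrib_left)

section \<open>Fourier, phase and derivative matrices; invertibility of
  \<open>Pf_mat\<close>\<close>

lemma Fourier_mat_carrier [simp]: "Fourier_mat K N \<in> carrier_mat K N"
  by (simp add: Fourier_mat_def)

lemma Phi_mat_carrier [simp]: "Phi_mat K N Ncp \<in> carrier_mat K K"
  by (simp add: Phi_mat_def)

lemma B2_mat_carrier [simp]: "B2_mat K N V \<in> carrier_mat (Suc V) K"
  by (simp add: B2_mat_def)

lemma Pf_mat_carrier [simp]: "Pf_mat K N V \<in> carrier_mat (Suc V) (Suc V)"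
  unfolding Pf_mat_def by (intro smult_carrier_mat mult_carrier_mat[of _ _ K]) auto

text \<open>Each entry is a geometric sum over the powers of an N-th root of unity, which is 1 only
  on the diagonal because K \<le> N keeps the subcarriers distinct modulo N.\<close>

lemma Fourier_mat_mult_adjoint:
  assumes "0 < N" "K \<le> N"
  shows "Fourier_mat K N * mat_adjoint (Fourier_mat K N) = of_nat N \<cdot>\<^sub>m 1\<^sub>m K"
proof (rule eq_matI)
  fix a b assume "a < dim_row (of_nat N \<cdot>\<^sub>m 1\<^sub>m K :: complex mat)"
    "b < dim_col (of_nat N \<cdot>\<^sub>m 1\<^sub>m K :: complex mat)"
  then have ab: "a < K" "b < K" by auto
  \<comment> \<open>The offset \<open>K div 2\<close> cancels in the difference of two subcarriers,
    so only b - a remains.\<close>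
  define z where "z = exp (\<i> * of_real (2 * pi * of_int (int b - int a) / real N))"
  have expo: "exp (- \<i> * 2 * of_real pi * of_int (subcarrier K a) * of_nat n / of_nat N) *
    cnj (exp (- \<i> * 2 * of_real pi * of_int (subcarrier K b) * of_nat n / of_nat N)) = z ^ n" for n
    by (simp add: z_def exp_of_nat_mult[symmetric] exp_add[symmetric] exp_cnj subcarrier_def
      field_simps diff_divide_distrib add_divide_distrib)
  have "(Fourier_mat K N * mat_adjoint (Fourier_mat K N)) $$ (a, b) = (\<Sum>n<N. z ^ n)"
    unfolding expo[symmetric] using ab
    by (auto simp: Fourier_mat_def scalar_prod_def lessThan_atLeast0)
  also have "\<dots> = (if a = b then of_nat N else 0)"
  proof (cases "a = b")
    case False
    have "z ^ N = exp (\<i> * of_real (2 * pi * of_int (int b - int a)))"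
      using assms by (simp add: z_def exp_of_nat_mult[symmetric])
    also have "\<dots> = 1"
      by (subst exp_eq_1) (auto intro!: exI[of _ "int b - int a"])
    finally have "z ^ N = 1" .
    moreover have "z \<noteq> 1"
    proof
      assume "z = 1"
      then obtain k :: int where "2 * pi * of_int (int b - int a) / real N = of_int (2 * k) * pi"
        unfolding z_def exp_eq_1 by (auto simp del: of_int_diff of_int_mult)
      then have "2 * pi * of_int (int b - int a) = 2 * pi * of_int (k * int N)"
        using assms by (simp add: field_simps)
      then have "real_of_int (int b - int a) = of_int (k * int N)"
        by (simp del: of_int_diff of_int_mult)
      then have "int b - int a = k * int N" by (simp only: of_int_eq_iff)
      then have "int N dvd int b - int a" by simp
      \<comment> \<open>A nonzero multiple of N has absolute value at least N, while two indices
        below K \<le> N differ by less.\<close>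
      moreover have "int b - int a \<noteq> 0" "\<bar>int b - int a\<bar> < int N" using ab False assms by auto
      ultimately show False using dvd_imp_le_int[of "int b - int a" "int N"] by linarith
    qed
    ultimately show ?thesis
      using False by (simp add: geometric_sum)
  qed (simp add: z_def)
  finally show "(Fourier_mat K N * mat_adjoint (Fourier_mat K N)) $$ (a, b)
      = (of_nat N \<cdot>\<^sub>m 1\<^sub>m K) $$ (a, b)"
    using ab by simp
qed (auto simp: Fourier_mat_def)

lemma Phi_mat_mult_adjoint: "Phi_mat K N Ncp * mat_adjoint (Phi_mat K N Ncp) = 1\<^sub>m K"
proof -
  define e where "e m = exp (\<i> * of_real (cp_phase N Ncp) * of_int (subcarrier K m))" for m
  have e: "cnj (e m) * e m = 1" for m
    by (simp add: e_def exp_cnj exp_add[symmetric])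
  have "mat_adjoint (Phi_mat K N Ncp) = mat_diag K (\<lambda>m. cnj (e m))"
    by (intro eq_matI) (auto simp: Phi_mat_def mat_diag_def e_def)
  moreover have "Phi_mat K N Ncp = mat_diag K e"
    by (simp add: Phi_mat_def e_def[abs_def])
  ultimately show "Phi_mat K N Ncp * mat_adjoint (Phi_mat K N Ncp) = 1\<^sub>m K"
    using e by (simp add: mult.commute)
qed

definition sign_mat :: "nat \<Rightarrow> complex mat" where
  "sign_mat n = mat_diag n (\<lambda>v. (-1) ^ v)"

lemma sign_mat_carrier [simp]: "sign_mat n \<in> carrier_mat n n"
  by (simp add: sign_mat_def)

lemma sign_mat_square: "sign_mat n * sign_mat n = 1\<^sub>m n"
  by (simp add: sign_mat_def power_mult_distrib[symmetric])

text \<open>The nodes are purely imaginary, so conjugation negates them and multiplies their v-th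
  power by (-1)^v.\<close>

lemma mat_adjoint_B2_mat:
  "mat_adjoint (B2_mat K N V) = transpose_mat (B2_mat K N V) * sign_mat (Suc V)"
proof (rule eq_matI)
  fix m v assume "m < dim_row (transpose_mat (B2_mat K N V) * sign_mat (Suc V))"
    "v < dim_col (transpose_mat (B2_mat K N V) * sign_mat (Suc V))"
  then have mv: "m < K" "v < Suc V" by (auto simp: B2_mat_def sign_mat_def mat_diag_def)
  define x where "x = 2 * of_real pi / of_nat N * of_int (subcarrier K m) * \<i>"
  have "cnj x = - x" by (simp add: x_def)
  then have "cnj (x ^ v) = x ^ v * (-1) ^ v"
    by (simp add: power_mult_distrib[symmetric])
  then show "mat_adjoint (B2_mat K N V) $$ (m, v)
      = (transpose_mat (B2_mat K N V) * sign_mat (Suc V)) $$ (m, v)"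
    using mv unfolding sign_mat_def
    by (subst mat_diag_mult_right[of _ K]) (auto simp: B2_mat_def x_def mult_ac)
qed (auto simp: B2_mat_def sign_mat_def mat_diag_def)

lemma mat_adjoint_transpose_B2_mat:
  "mat_adjoint (transpose_mat (B2_mat K N V)) = sign_mat (Suc V) * B2_mat K N V"
proof -
  have "mat_adjoint (transpose_mat (B2_mat K N V)) = transpose_mat (mat_adjoint (B2_mat K N V))"
    by (intro eq_matI) auto
  also have "\<dots> = transpose_mat (sign_mat (Suc V)) * B2_mat K N V"
    unfolding mat_adjoint_B2_mat by (subst transpose_mult[of _ K "Suc V" _ "Suc V"]) auto
  also have "transpose_mat (sign_mat (Suc V)) = sign_mat (Suc V)"
    by (intro eq_matI) (auto simp: sign_mat_def mat_diag_def)
  finally show ?thesis .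
qed

text \<open>A kernel vector v gives u = B^T v with B u = 0. The sign relation between transpose and
  adjoint turns this into u^H u = 0, hence u = 0. The entries of u are the values at the K nodes of
  the polynomial with coefficients v, which has degree at most V < K.\<close>

lemma Pf_mat_det_nonzero:
  assumes "0 < N" "V + 1 \<le> K"
  shows "det (Pf_mat K N V) \<noteq> 0"
proof
  let ?B = "B2_mat K N V"
  assume "det (Pf_mat K N V) = 0"
  then obtain v where v: "v \<in> carrier_vec (Suc V)" "v \<noteq> 0\<^sub>v (Suc V)"
    and "Pf_mat K N V *\<^sub>v v = 0\<^sub>v (Suc V)"
    using det_0_iff_vec_prod_zero[OF Pf_mat_carrier] by blast
  moreover have "Pf_mat K N V *\<^sub>v v = (1 / of_nat N) \<cdot>\<^sub>v ((?B * transpose_mat ?B) *\<^sub>v v)"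
    unfolding Pf_mat_def using v(1)
    by (intro smult_mat_mult_vec[of _ "Suc V" "Suc V"] mult_carrier_mat[of _ _ K]) auto
  ultimately have "(1 / of_nat N) \<cdot>\<^sub>v ((?B * transpose_mat ?B) *\<^sub>v v) = 0\<^sub>v (Suc V)"
    by simp
  then have "of_nat N \<cdot>\<^sub>v ((1 / of_nat N) \<cdot>\<^sub>v ((?B * transpose_mat ?B) *\<^sub>v v)) = of_nat N \<cdot>\<^sub>v 0\<^sub>v (Suc V)"
    by simp
  then have "(?B * transpose_mat ?B) *\<^sub>v v = 0\<^sub>v (Suc V)"
    using assms by (auto simp: smult_smult_assoc)
  moreover define u where "u = transpose_mat ?B *\<^sub>v v"
  ultimately have Bu: "?B *\<^sub>v u = 0\<^sub>v (Suc V)"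
    using v by (simp add: assoc_mult_mat_vec[of _ "Suc V" K _ "Suc V"])
  have u: "u \<in> carrier_vec K"
    unfolding u_def using v by (intro mult_mat_vec_carrier) auto
  \<comment> \<open>Moving \<open>transpose_mat ?B\<close> across the Hermitian product produces its
    adjoint \<open>sign_mat (Suc V) * ?B\<close>, which annihilates u by \<open>Bu\<close>.\<close>
  have "conjugate u \<bullet> u = conjugate (mat_adjoint (transpose_mat ?B) *\<^sub>v u) \<bullet> v"
    using conjugate_scalar_prod_mult_mat_vec[of "transpose_mat ?B" K "Suc V" u v] u v(1)
    by (simp add: u_def)
  also have "mat_adjoint (transpose_mat ?B) *\<^sub>v u = 0\<^sub>v (Suc V)"
    unfolding mat_adjoint_transpose_B2_mat
    using Bu u by (subst assoc_mult_mat_vec[of _ "Suc V" "Suc V" _ K]) (auto simp: mult_mat_vec_zero)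
  finally have "u = 0\<^sub>v K"
    using conjugate_scalar_prod_self_eq_0D[OF _ u] v(1) by simp
  define z where "z m = \<i> * (2 * of_real pi / of_nat N) * of_int (subcarrier K m)" for m
  have "(\<Sum>j\<le>V. v $ j * z m ^ j) = 0" if "m < K" for m
  proof -
    have "u $ m = (\<Sum>j\<le>V. v $ j * z m ^ j)"
      using that v(1) by (auto simp: u_def B2_mat_def scalar_prod_def z_def mult_ac lessThan_Suc_atMost
        simp flip: lessThan_atLeast0)
    then show ?thesis using \<open>u = 0\<^sub>v K\<close> that by simp
  qed
  then have roots: "z ` {..<K} \<subseteq> {x. (\<Sum>j\<le>V. v $ j * x ^ j) = 0}" by auto
  \<comment> \<open>Here 0 < N matters: it keeps the factor 2 pi / N nonzero.\<close>
  have "inj z" using assms by (auto simp: inj_def z_def subcarrier_def)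
  then have "card (z ` {..<K}) = K" by (simp add: card_image inj_on_subset)
  moreover obtain k where "k \<le> V" "v $ k \<noteq> 0"
  proof (rule ccontr)
    assume "\<not> thesis"
    with that have "v = 0\<^sub>v (Suc V)"
      using v(1) by (intro eq_vecI) (auto simp: less_Suc_eq_le)
    with v(2) show False ..
  qed
  ultimately show False
  proof -
    from \<open>k \<le> V\<close> \<open>v $ k \<noteq> 0\<close>
    have "finite {x. (\<Sum>j\<le>V. v $ j * x ^ j) = 0} \<and> card {x. (\<Sum>j\<le>V. v $ j * x ^ j) = 0} \<le> V"
      using polyfun_rootbound[of V "\<lambda>j. v $ j"] by blast
    then have "card (z ` {..<K}) \<le> V"
      using card_mono[OF _ roots] by linarith
    then show False using \<open>card (z ` {..<K}) = K\<close> assms(2) by simp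
  qed
qed

lemma Pf_inv:
  assumes "0 < N" "V + 1 \<le> K"
  shows "Pf_inv K N V \<in> carrier_mat (Suc V) (Suc V)"
    "Pf_inv K N V * Pf_mat K N V = 1\<^sub>m (Suc V)" "Pf_mat K N V * Pf_inv K N V = 1\<^sub>m (Suc V)"
proof -
  have "Pf_mat K N V \<in> Units (ring_mat TYPE(complex) (Suc V) ())"
    by (rule det_non_zero_imp_unit[OF Pf_mat_carrier Pf_mat_det_nonzero[OF assms]])
  then obtain R where "mat_inverse (Pf_mat K N V) = Some R"
    using mat_inverse(1)[OF Pf_mat_carrier, where b = "()"] by (cases "mat_inverse (Pf_mat K N V)") auto
  then show "Pf_inv K N V \<in> carrier_mat (Suc V) (Suc V)"
    "Pf_inv K N V * Pf_mat K N V = 1\<^sub>m (Suc V)" "Pf_mat K N V * Pf_inv K N V = 1\<^sub>m (Suc V)"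
    using mat_inverse(2)[OF Pf_mat_carrier] by (auto simp: Pf_inv_def)
qed


section \<open>Second moments of square-integrable random vectors\<close>

text \<open>Stated with the complex products that form the diagonal of \<open>cross_corr\<close>, so
  that it can be read off from the data covariance.\<close>

definition square_integrable_vec :: "'w measure \<Rightarrow> nat \<Rightarrow> ('w \<Rightarrow> complex vec) \<Rightarrow> bool" where
  "square_integrable_vec M d X \<longleftrightarrow> random_vec M d X \<and>
     (\<forall>m<d. integrable M (\<lambda>\<omega>. X \<omega> $ m * cnj (X \<omega> $ m)))"

lemma square_integrable_vec_carrier: "square_integrable_vec M d X \<Longrightarrow> X \<omega> \<in> carrier_vec d"
  by (simp add: square_integrable_vec_def random_vec_def)

lemma square_integrable_vec_measurable:
  "square_integrable_vec M d X \<Longrightarrow> m < d \<Longrightarrow> (\<lambda>\<omega>. X \<omega> $ m) \<in> borel_measurable M"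
  by (simp add: square_integrable_vec_def random_vec_def)

text \<open>The pointwise bound |ab| \<le> |a|^2 + |b|^2 reduces every mixed moment to two diagonal
  ones.\<close>

lemma square_integrable_vec_integrable:
  assumes X: "square_integrable_vec M d X" and Y: "square_integrable_vec M d Y" and mn: "m < d" "n < d"
  shows "integrable M (\<lambda>\<omega>. X \<omega> $ m * cnj (Y \<omega> $ n))"
proof (rule Bochner_Integration.integrable_bound)
  show "integrable M (\<lambda>\<omega>. cmod (X \<omega> $ m * cnj (X \<omega> $ m)) + cmod (Y \<omega> $ n * cnj (Y \<omega> $ n)))"
    using X Y mn unfolding square_integrable_vec_def
    by (intro Bochner_Integration.integrable_add integrable_norm) auto
  note [measurable] = square_integrable_vec_measurable[OF X mn(1)]
    square_integrable_vec_measurable[OF Y mn(2)]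
  have "(\<lambda>\<omega>. cnj (Y \<omega> $ n)) \<in> borel_measurable M"
    by (rule borel_measurable_continuous_on[OF _ square_integrable_vec_measurable[OF Y mn(2)]])
      (intro continuous_intros)
  then show "(\<lambda>\<omega>. X \<omega> $ m * cnj (Y \<omega> $ n)) \<in> borel_measurable M"
    by measurable
  have "a * b \<le> a * a + b * b" if "a \<ge> 0" "b \<ge> 0" for a b :: real
    using sum_squares_bound[of a b] that mult_nonneg_nonneg[OF that] unfolding power2_eq_square by linarith
  then show "AE \<omega> in M. norm (X \<omega> $ m * cnj (Y \<omega> $ n))
      \<le> norm (cmod (X \<omega> $ m * cnj (X \<omega> $ m)) + cmod (Y \<omega> $ n * cnj (Y \<omega> $ n)))"
    by (simp add: norm_mult)
qed

lemma index_mult_mat_vec_sum: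
  "A \<in> carrier_mat n m \<Longrightarrow> v \<in> carrier_vec m \<Longrightarrow> i < n \<Longrightarrow> (A *\<^sub>v v) $ i = (\<Sum>j<m. A $$ (i, j) * v $ j)"
  by (auto simp: scalar_prod_def lessThan_atLeast0)

lemma square_integrable_vec_mult:
  assumes A: "A \<in> carrier_mat d d" and X: "square_integrable_vec M d X"
  shows "square_integrable_vec M d (\<lambda>\<omega>. A *\<^sub>v X \<omega>)"
  unfolding square_integrable_vec_def random_vec_def
proof (intro conjI allI impI)
  note XC = square_integrable_vec_carrier[OF X]
  show "A *\<^sub>v X \<omega> \<in> carrier_vec d" for \<omega> using A XC by auto
  fix m assume m: "m < d"
  have e: "(\<lambda>\<omega>. (A *\<^sub>v X \<omega>) $ m) = (\<lambda>\<omega>. \<Sum>j<d. A $$ (m, j) * X \<omega> $ j)"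
    by (intro ext index_mult_mat_vec_sum[OF A XC m])
  show "(\<lambda>\<omega>. (A *\<^sub>v X \<omega>) $ m) \<in> borel_measurable M"
    unfolding e using square_integrable_vec_measurable[OF X]
    by (intro borel_measurable_sum borel_measurable_times borel_measurable_const) auto
  have "(A *\<^sub>v X \<omega>) $ m * cnj ((A *\<^sub>v X \<omega>) $ m) =
      (\<Sum>j<d. \<Sum>k<d. (A $$ (m, j) * cnj (A $$ (m, k))) * (X \<omega> $ j * cnj (X \<omega> $ k)))" for \<omega>
    unfolding index_mult_mat_vec_sum[OF A XC m] cnj_sum sum_product
    by (simp add: mult_ac)
  then show "integrable M (\<lambda>\<omega>. (A *\<^sub>v X \<omega>) $ m * cnj ((A *\<^sub>v X \<omega>) $ m))"
    using square_integrable_vec_integrable[OF X X]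
    by (auto intro!: Bochner_Integration.integrable_sum integrable_mult_right)
qed

lemma square_integrable_vec_add:
  assumes X: "square_integrable_vec M d X" and Y: "square_integrable_vec M d Y"
  shows "square_integrable_vec M d (\<lambda>\<omega>. X \<omega> + Y \<omega>)"
  unfolding square_integrable_vec_def random_vec_def
proof (intro conjI allI impI)
  note XC = square_integrable_vec_carrier[OF X] and YC = square_integrable_vec_carrier[OF Y]
  show "X \<omega> + Y \<omega> \<in> carrier_vec d" for \<omega> using XC YC by auto
  fix m assume m: "m < d"
  have e: "(X \<omega> + Y \<omega>) $ m = X \<omega> $ m + Y \<omega> $ m" for \<omega>
    using carrier_vecD[OF YC] m by simp
  show "(\<lambda>\<omega>. (X \<omega> + Y \<omega>) $ m) \<in> borel_measurable M"
    unfolding e using square_integrable_vec_measurable[OF X m] square_integrable_vec_measurable[OF Y m]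
    by (intro borel_measurable_add)
  have "(X \<omega> + Y \<omega>) $ m * cnj ((X \<omega> + Y \<omega>) $ m) =
      (X \<omega> $ m * cnj (X \<omega> $ m) + X \<omega> $ m * cnj (Y \<omega> $ m)) +
      (Y \<omega> $ m * cnj (X \<omega> $ m) + Y \<omega> $ m * cnj (Y \<omega> $ m))" for \<omega>
    unfolding e by (simp add: algebra_simps)
  then show "integrable M (\<lambda>\<omega>. (X \<omega> + Y \<omega>) $ m * cnj ((X \<omega> + Y \<omega>) $ m))"
    using X Y m by (auto intro!: Bochner_Integration.integrable_add square_integrable_vec_integrable)
qed

lemma cross_corr_carrier [simp]: "cross_corr M d X Y \<in> carrier_mat d d"
  by (simp add: cross_corr_def)

lemma cross_corr_mult_left:
  assumes A: "A \<in> carrier_mat d d"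
    and X: "square_integrable_vec M d X" and Y: "square_integrable_vec M d Y"
  shows "cross_corr M d (\<lambda>\<omega>. A *\<^sub>v X \<omega>) Y = A * cross_corr M d X Y"
proof (rule eq_matI)
  note XC = square_integrable_vec_carrier[OF X]
  fix m n assume "m < dim_row (A * cross_corr M d X Y)" "n < dim_col (A * cross_corr M d X Y)"
  with A have mn: "m < d" "n < d" by (auto simp: cross_corr_def)
  have "cross_corr M d (\<lambda>\<omega>. A *\<^sub>v X \<omega>) Y $$ (m, n) =
      (\<integral>\<omega>. (\<Sum>j<d. A $$ (m, j) * (X \<omega> $ j * cnj (Y \<omega> $ n))) \<partial>M)"
    using mn by (simp add: cross_corr_def index_mult_mat_vec_sum[OF A XC] sum_distrib_right mult.assoc)
  also have "\<dots> = (\<Sum>j<d. A $$ (m, j) * (\<integral>\<omega>. X \<omega> $ j * cnj (Y \<omega> $ n) \<partial>M))"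
    using mn square_integrable_vec_integrable[OF X Y]
    by (subst Bochner_Integration.integral_sum) (auto intro!: integrable_mult_right)
  also have "\<dots> = (A * cross_corr M d X Y) $$ (m, n)"
    using mn A by (auto simp: cross_corr_def scalar_prod_def lessThan_atLeast0)
  finally show "cross_corr M d (\<lambda>\<omega>. A *\<^sub>v X \<omega>) Y $$ (m, n) = (A * cross_corr M d X Y) $$ (m, n)" .
qed (use A in \<open>auto simp: cross_corr_def\<close>)

lemma cross_corr_add_left:
  assumes X: "square_integrable_vec M d X" and Y: "square_integrable_vec M d Y"
    and Z: "square_integrable_vec M d Z"
  shows "cross_corr M d (\<lambda>\<omega>. X \<omega> + Y \<omega>) Z = cross_corr M d X Z + cross_corr M d Y Z"
proof (rule eq_matI)
  note YC = square_integrable_vec_carrier[OF Y]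
  fix m n assume "m < dim_row (cross_corr M d X Z + cross_corr M d Y Z)"
    "n < dim_col (cross_corr M d X Z + cross_corr M d Y Z)"
  then have mn: "m < d" "n < d" by (auto simp: cross_corr_def)
  then show "cross_corr M d (\<lambda>\<omega>. X \<omega> + Y \<omega>) Z $$ (m, n)
      = (cross_corr M d X Z + cross_corr M d Y Z) $$ (m, n)"
    using carrier_vecD[OF YC] square_integrable_vec_integrable[OF X Z mn]
      square_integrable_vec_integrable[OF Y Z mn]
    by (simp add: cross_corr_def distrib_right)
qed (auto simp: cross_corr_def)

text \<open>Transfers linearity from the first argument to the second, where coefficients appear as
  adjoints.\<close>

lemma mat_adjoint_cross_corr: "mat_adjoint (cross_corr M d X Y) = cross_corr M d Y X"
  by (intro eq_matI) (auto simp: cross_corr_def mult.commute simp flip: Bochner_Integration.integral_cnj)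

lemma cross_corr_lin_comb_left:
  assumes "A \<in> carrier_mat d d" "B \<in> carrier_mat d d"
    and "square_integrable_vec M d X" "square_integrable_vec M d Y" "square_integrable_vec M d Z"
  shows "cross_corr M d (\<lambda>\<omega>. A *\<^sub>v X \<omega> + B *\<^sub>v Y \<omega>) Z
    = A * cross_corr M d X Z + B * cross_corr M d Y Z"
  using assms by (simp add: cross_corr_add_left cross_corr_mult_left square_integrable_vec_mult)

text \<open>The mixed terms vanish. Applied with X the previous spectrum and Y the current data,
  once for the smoothed spectrum and once for the smooth signal.\<close>

lemma cross_corr_lin_comb_self:
  assumes A: "A \<in> carrier_mat d d" and B: "B \<in> carrier_mat d d"
    and X: "square_integrable_vec M d X" and Y: "square_integrable_vec M d Y"
    and XX: "cross_corr M d X X = 1\<^sub>m d" and YY: "cross_corr M d Y Y = 1\<^sub>m d"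
    and XY: "cross_corr M d X Y = 0\<^sub>m d d"
  shows "cross_corr M d (\<lambda>\<omega>. A *\<^sub>v X \<omega> + B *\<^sub>v Y \<omega>) (\<lambda>\<omega>. A *\<^sub>v X \<omega> + B *\<^sub>v Y \<omega>)
    = A * mat_adjoint A + B * mat_adjoint B"
proof -
  let ?Z = "\<lambda>\<omega>. A *\<^sub>v X \<omega> + B *\<^sub>v Y \<omega>"
  have Z: "square_integrable_vec M d ?Z"
    using A B X Y by (intro square_integrable_vec_add square_integrable_vec_mult)
  have YX: "cross_corr M d Y X = 0\<^sub>m d d"
    unfolding mat_adjoint_cross_corr[of M d X Y, symmetric] XY by (intro eq_matI) auto
  have "cross_corr M d X ?Z = mat_adjoint A"
    unfolding mat_adjoint_cross_corr[of M d ?Z X, symmetric]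
    using A B X Y by (simp add: cross_corr_lin_comb_left XX YX)
  moreover have "cross_corr M d Y ?Z = mat_adjoint B"
    unfolding mat_adjoint_cross_corr[of M d ?Z Y, symmetric]
    using A B X Y by (simp add: cross_corr_lin_comb_left YY XY)
  ultimately show ?thesis
    using cross_corr_lin_comb_left[OF A B X Y Z] by simp
qed

text \<open>v^H v is the trace of v v^H, and the trace, a finite sum, commutes with the
  expectation.\<close>

lemma avg_power_eq_mat_trace:
  assumes X: "square_integrable_vec M d X"
  shows "avg_power M X = mat_trace (cross_corr M d X X)"
proof -
  have "conjugate (X \<omega>) \<bullet> X \<omega> = (\<Sum>m<d. X \<omega> $ m * cnj (X \<omega> $ m))" for \<omega>
    using square_integrable_vec_carrier[OF X, of \<omega>]
    by (auto simp: scalar_prod_def lessThan_atLeast0 mult.commute)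
  then show ?thesis
    using square_integrable_vec_integrable[OF X X]
    by (simp add: avg_power_def cross_corr_def mat_trace_def)
qed

lemma uncorrelated_data_square_integrable:
  assumes "uncorrelated_data M K X"
  shows "square_integrable_vec M K (X i)"
  unfolding square_integrable_vec_def
proof (intro conjI allI impI)
  show "random_vec M K (X i)" using assms by (simp add: uncorrelated_data_def)
  fix m assume m: "m < K"
  have "(\<integral>\<omega>. X i \<omega> $ m * cnj (X i \<omega> $ m) \<partial>M) = cross_corr M K (X i) (X i) $$ (m, m)"
    using m by (simp add: cross_corr_def)
  also have "\<dots> = 1" using assms m by (simp add: uncorrelated_data_def)
  finally show "integrable M (\<lambda>\<omega>. X i \<omega> $ m * cnj (X i \<omega> $ m))"
    \<comment> \<open>A non-integrable function would have integral 0, not 1.\<close>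
    using not_integrable_integral_eq by fastforce
qed

section \<open>The projection behind the smoothing\<close>

lemma B1_mat_carrier: "B1_mat K N Ncp V \<in> carrier_mat K (Suc V)"
  unfolding B1_mat_def by (intro mult_carrier_mat[of _ K K]) auto

text \<open>The matrix G of the overview. Since B B^T is N times \<open>Pf_mat\<close>, its inverse
  is 1/N times \<open>Pf_inv\<close>, which explains the leading factor.\<close>

definition smoothing_proj :: "nat \<Rightarrow> nat \<Rightarrow> nat \<Rightarrow> complex mat" where
  "smoothing_proj K N V =
     (1 / of_nat N) \<cdot>\<^sub>m (transpose_mat (B2_mat K N V) * (Pf_inv K N V * B2_mat K N V))"

context
  fixes K N V :: nat
  assumes N: "0 < N" and VK: "V + 1 \<le> K"
begin

private abbreviation "B \<equiv> B2_mat K N V"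
private abbreviation "T \<equiv> transpose_mat (B2_mat K N V)"
private abbreviation "R \<equiv> Pf_inv K N V"
private abbreviation "S \<equiv> sign_mat (Suc V)"
private abbreviation "P \<equiv> Pf_mat K N V"

private lemma carriers:
  "B \<in> carrier_mat (Suc V) K" "T \<in> carrier_mat K (Suc V)" "R \<in> carrier_mat (Suc V) (Suc V)"
  "S \<in> carrier_mat (Suc V) (Suc V)" "P \<in> carrier_mat (Suc V) (Suc V)"
  "R * B \<in> carrier_mat (Suc V) K" "T * (R * B) \<in> carrier_mat K K"
  "B * T \<in> carrier_mat (Suc V) (Suc V)" "mat_adjoint R \<in> carrier_mat (Suc V) (Suc V)"
proof -
  show "B \<in> carrier_mat (Suc V) K" by simp
  then show T: "T \<in> carrier_mat K (Suc V)" "B * T \<in> carrier_mat (Suc V) (Suc V)"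
    by (auto intro: mult_carrier_mat[of _ _ K])
  show "R \<in> carrier_mat (Suc V) (Suc V)" using Pf_inv(1)[OF N VK] by simp
  then show "R * B \<in> carrier_mat (Suc V) K" "mat_adjoint R \<in> carrier_mat (Suc V) (Suc V)"
    by (auto intro: mult_carrier_mat[of _ _ "Suc V"])
  then show "T * (R * B) \<in> carrier_mat K K" using T by (auto intro: mult_carrier_mat[of _ _ "Suc V"])
qed simp_all

private lemma gram: "B * T = of_nat N \<cdot>\<^sub>m P"
  using N unfolding Pf_mat_def by (intro eq_matI) auto

private lemma inverse: "R * P = 1\<^sub>m (Suc V)" "P * R = 1\<^sub>m (Suc V)"
  using Pf_inv(2,3)[OF N VK] by simp_all

lemma smoothing_proj_carrier: "smoothing_proj K N V \<in> carrier_mat K K"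
  unfolding smoothing_proj_def using carriers by simp

text \<open>In the square the inner block R B T collapses to N times the identity, and this N
  cancels one of the two factors 1/N.\<close>

lemma smoothing_proj_idem: "smoothing_proj K N V * smoothing_proj K N V = smoothing_proj K N V"
proof -
  note [simp] = carriers
  have "(T * (R * B)) * (T * (R * B)) = T * ((R * B) * (T * (R * B)))"
    by (rule assoc_mult_mat[of _ K "Suc V" _ K _ K]) simp_all
  also have "(R * B) * (T * (R * B)) = ((R * B) * T) * (R * B)"
    by (rule assoc_mult_mat[symmetric, of _ "Suc V" K _ "Suc V" _ K]) simp_all
  also have "(R * B) * T = R * (B * T)"
    by (rule assoc_mult_mat[of _ "Suc V" "Suc V" _ K _ "Suc V"]) simp_all
  also have "\<dots> = of_nat N \<cdot>\<^sub>m 1\<^sub>m (Suc V)"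
    unfolding gram by (simp add: mult_smult_distrib[of _ "Suc V" "Suc V" _ "Suc V"] inverse)
  also have "\<dots> * (R * B) = of_nat N \<cdot>\<^sub>m (R * B)"
    by (simp add: mult_smult_assoc_mat[of _ "Suc V" "Suc V" _ K] left_mult_one_mat[of _ "Suc V" K])
  also have "T * \<dots> = of_nat N \<cdot>\<^sub>m (T * (R * B))"
    by (rule mult_smult_distrib[of _ K "Suc V" _ K]) simp_all
  finally have "(T * (R * B)) * (T * (R * B)) = of_nat N \<cdot>\<^sub>m (T * (R * B))" .
  then show ?thesis
    using N unfolding smoothing_proj_def
    by (simp add: mult_smult_assoc_mat[of _ K K _ K] mult_smult_distrib[of _ K K _ K]
        smult_smult_mat)
qed

text \<open>Conjugating both factors of B T gives P^H = S P S. As S is its own inverse, S R S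
  inverts P^H, and so does R^H; inverses are unique.\<close>

lemma mat_adjoint_Pf_inv: "mat_adjoint R = S * (R * S)"
proof -
  note [simp] = carriers
  note assoc = assoc_mult_mat[of _ "Suc V" "Suc V" _ "Suc V" _ "Suc V"]
  note mc = mult_carrier_mat[of _ "Suc V" "Suc V" _ "Suc V"]
  \<comment> \<open>Cancellation in right-nested products, the shape into which \<open>assoc\<close>
    brings every product.\<close>
  have SS: "S * (S * A) = A" if "A \<in> carrier_mat (Suc V) (Suc V)" for A
    using that assoc[of S S A] by (simp add: sign_mat_square)
  have PR: "P * (R * A) = A" if "A \<in> carrier_mat (Suc V) (Suc V)" for A
    using that assoc[of P R A] by (simp add: inverse)
  have "mat_adjoint (B * T) = (S * B) * (T * S)"
    by (simp add: mat_adjoint_mult[of _ "Suc V" K _ "Suc V"] mat_adjoint_B2_mat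
        mat_adjoint_transpose_B2_mat)
  also have "\<dots> = S * (B * (T * S))"
    by (rule assoc_mult_mat[of _ "Suc V" "Suc V" _ K _ "Suc V"]) (simp_all add: mult_carrier_mat[of _ _ "Suc V"])
  also have "B * (T * S) = (B * T) * S"
    by (rule assoc_mult_mat[symmetric, of _ "Suc V" K _ "Suc V" _ "Suc V"]) simp_all
  finally have "mat_adjoint (B * T) = S * ((B * T) * S)" .
  then have "of_nat N \<cdot>\<^sub>m mat_adjoint P = of_nat N \<cdot>\<^sub>m (S * (P * S))"
    unfolding gram mat_adjoint_smult
    by (simp add: mult_smult_assoc_mat[of _ "Suc V" "Suc V" _ "Suc V"]
        mult_smult_distrib[of _ "Suc V" "Suc V" _ "Suc V"] mc)
  then have "(1 / of_nat N) \<cdot>\<^sub>m (of_nat N \<cdot>\<^sub>m mat_adjoint P)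
      = (1 / of_nat N) \<cdot>\<^sub>m (of_nat N \<cdot>\<^sub>m (S * (P * S)))"
    by simp
  then have adj: "mat_adjoint P = S * (P * S)"
    using N by (simp add: smult_smult_mat one_smult_mat)
  have "mat_adjoint R * mat_adjoint P = 1\<^sub>m (Suc V)"
    using mat_adjoint_mult[of P "Suc V" "Suc V" R "Suc V"] by (simp add: inverse)
  moreover have "mat_adjoint P * (S * (R * S)) = 1\<^sub>m (Suc V)"
    unfolding adj by (simp add: assoc mc SS PR sign_mat_square)
  ultimately show ?thesis
    using assoc[of "mat_adjoint R" "mat_adjoint P" "S * (R * S)"]
    by (simp add: mc left_mult_one_mat[of _ "Suc V" "Suc V"] right_mult_one_mat[of _ "Suc V" "Suc V"])
qed

text \<open>The adjoints of B, R and T are T S, S R S and S B, so the sign matrices meet in pairs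
  and cancel.\<close>

lemma mat_adjoint_smoothing_proj: "mat_adjoint (smoothing_proj K N V) = smoothing_proj K N V"
proof -
  note [simp] = carriers
  note mc = mult_carrier_mat[of _ "Suc V" "Suc V"] mult_carrier_mat[of _ K "Suc V"]
  have "mat_adjoint (T * (R * B)) = (mat_adjoint B * mat_adjoint R) * mat_adjoint T"
    by (simp add: mat_adjoint_mult[of _ K "Suc V" _ K] mat_adjoint_mult[of _ "Suc V" "Suc V" _ K])
  also have "\<dots> = ((T * S) * (S * (R * S))) * (S * B)"
    by (simp add: mat_adjoint_B2_mat mat_adjoint_transpose_B2_mat mat_adjoint_Pf_inv)
  also have "(T * S) * (S * (R * S)) = T * (S * (S * (R * S)))"
    by (rule assoc_mult_mat[of _ K "Suc V" _ "Suc V" _ "Suc V"]) (simp_all add: mc)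
  also have "S * (S * (R * S)) = (S * S) * (R * S)"
    by (rule assoc_mult_mat[symmetric, of _ "Suc V" "Suc V" _ "Suc V" _ "Suc V"]) (simp_all add: mc)
  also have "\<dots> = R * S"
    by (simp add: sign_mat_square mc left_mult_one_mat[of _ "Suc V" "Suc V"])
  also have "(T * (R * S)) * (S * B) = T * ((R * S) * (S * B))"
    by (rule assoc_mult_mat[of _ K "Suc V" _ "Suc V" _ K]) (simp_all add: mc)
  also have "(R * S) * (S * B) = R * (S * (S * B))"
    by (rule assoc_mult_mat[of _ "Suc V" "Suc V" _ "Suc V" _ K]) (simp_all add: mc)
  also have "S * (S * B) = (S * S) * B"
    by (rule assoc_mult_mat[symmetric, of _ "Suc V" "Suc V" _ "Suc V" _ K]) (simp_all add: mc)
  also have "\<dots> = B" by (simp add: sign_mat_square left_mult_one_mat[of _ "Suc V" K])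
  finally show ?thesis by (simp add: smoothing_proj_def mat_adjoint_smult)
qed

text \<open>Cyclicity moves the trace from dimension K to dimension V + 1, where the product is N
  times the identity.\<close>

lemma mat_trace_smoothing_proj: "mat_trace (smoothing_proj K N V) = of_nat (V + 1)"
proof -
  note [simp] = carriers
  have "mat_trace (smoothing_proj K N V) = 1 / of_nat N * mat_trace (T * (R * B))"
    by (simp add: smoothing_proj_def mat_trace_smult[of _ K])
  also have "mat_trace (T * (R * B)) = mat_trace ((R * B) * T)"
    by (rule mat_trace_comm[of _ K "Suc V"]) simp_all
  also have "(R * B) * T = R * (B * T)"
    by (rule assoc_mult_mat[of _ "Suc V" "Suc V" _ K _ "Suc V"]) simp_all
  also have "\<dots> = of_nat N \<cdot>\<^sub>m 1\<^sub>m (Suc V)"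
    unfolding gram by (simp add: mult_smult_distrib[of _ "Suc V" "Suc V" _ "Suc V"] inverse)
  finally show ?thesis
    using N by (simp add: mat_trace_smult[of _ "Suc V"] mat_trace_one)
qed

section \<open>The smoothing recursion in the frequency domain\<close>

text \<open>At n = N all subcarrier phases are 1, so the derivatives of the previous symbol are B a
  / N; at n = -Ncp the phases are the diagonal of Phi. Both terms thus become B applied to a
  spectrum.\<close>

lemma smooth_coeff_ofdm_symbol:
  assumes KN: "K \<le> N" and a: "a \<in> carrier_vec K" and x: "x \<in> carrier_vec K"
  shows "smooth_coeff K N Ncp V (ofdm_symbol K N a) x =
    (1 / of_nat N) \<cdot>\<^sub>v (R *\<^sub>v (B *\<^sub>v (a - Phi_mat K N Ncp *\<^sub>v x)))"
proof -
  note [simp] = carriers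
  let ?F = "Fourier_mat K N" and ?Phi = "Phi_mat K N Ncp"
  note mv = mult_mat_vec_carrier
  have Fa: "mat_adjoint ?F *\<^sub>v a \<in> carrier_vec N" using a by (intro mv[of _ N K]) auto
  have Px: "?Phi *\<^sub>v x \<in> carrier_vec K" using x by (intro mv[of _ K K]) auto
  have Ba: "B *\<^sub>v a \<in> carrier_vec (Suc V)" using a by (intro mv[of _ _ K]) auto
  have BPx: "B *\<^sub>v (?Phi *\<^sub>v x) \<in> carrier_vec (Suc V)" by (rule mv[OF carriers(1) Px])
  have "?F *\<^sub>v (mat_adjoint ?F *\<^sub>v a) = (?F * mat_adjoint ?F) *\<^sub>v a"
    using a by (intro assoc_mult_mat_vec[symmetric, of _ K N _ K]) auto
  also have "\<dots> = of_nat N \<cdot>\<^sub>v a"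
    unfolding Fourier_mat_mult_adjoint[OF N KN] using a by (simp add: smult_mat_mult_vec[of _ K K])
  finally have FFa: "?F *\<^sub>v (mat_adjoint ?F *\<^sub>v a) = of_nat N \<cdot>\<^sub>v a" .
  have "P1_mat K N V *\<^sub>v ofdm_symbol K N a
      = (1 / of_nat N) \<cdot>\<^sub>v ((B * ?F) *\<^sub>v ((1 / of_nat N) \<cdot>\<^sub>v (mat_adjoint ?F *\<^sub>v a)))"
    unfolding P1_mat_def ofdm_symbol_def
    using Fa by (intro smult_mat_mult_vec[of _ "Suc V" N]) (auto intro: mult_carrier_mat[of _ _ K])
  also have "\<dots> = (1 / of_nat N) \<cdot>\<^sub>v (B *\<^sub>v (?F *\<^sub>v ((1 / of_nat N) \<cdot>\<^sub>v (mat_adjoint ?F *\<^sub>v a))))"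
    using Fa by (subst assoc_mult_mat_vec[of _ "Suc V" K _ N]) auto
  \<comment> \<open>Demodulation recovers the spectrum: F F^H = N I absorbs the 1/N of the OFDM
    symbol.\<close>
  also have "?F *\<^sub>v ((1 / of_nat N) \<cdot>\<^sub>v (mat_adjoint ?F *\<^sub>v a)) = a"
    using Fa N by (simp add: mult_mat_vec[of _ K N] FFa smult_smult_assoc)
  finally have P1: "P1_mat K N V *\<^sub>v ofdm_symbol K N a = (1 / of_nat N) \<cdot>\<^sub>v (B *\<^sub>v a)" .
  have "P2_mat K N Ncp V *\<^sub>v x = (1 / of_nat N) \<cdot>\<^sub>v ((B * ?Phi) *\<^sub>v x)"
    unfolding P2_mat_def using x
    by (intro smult_mat_mult_vec[of _ "Suc V" K]) (auto intro: mult_carrier_mat[of _ _ K])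
  also have "(B * ?Phi) *\<^sub>v x = B *\<^sub>v (?Phi *\<^sub>v x)"
    using x by (intro assoc_mult_mat_vec[of _ "Suc V" K _ K]) auto
  finally have "P1_mat K N V *\<^sub>v ofdm_symbol K N a - P2_mat K N Ncp V *\<^sub>v x
      = (1 / of_nat N) \<cdot>\<^sub>v (B *\<^sub>v a) - (1 / of_nat N) \<cdot>\<^sub>v (B *\<^sub>v (?Phi *\<^sub>v x))"
    unfolding P1 by simp
  also have "\<dots> = (1 / of_nat N) \<cdot>\<^sub>v (B *\<^sub>v a - B *\<^sub>v (?Phi *\<^sub>v x))"
    using Ba BPx by (intro eq_vecI) (auto simp: right_diff_distrib)
  also have "B *\<^sub>v a - B *\<^sub>v (?Phi *\<^sub>v x) = B *\<^sub>v (a - ?Phi *\<^sub>v x)"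
    using a Px by (intro mult_minus_distrib_mat_vec[symmetric, of _ "Suc V" K]) auto
  also have "R *\<^sub>v ((1 / of_nat N) \<cdot>\<^sub>v \<dots>) = (1 / of_nat N) \<cdot>\<^sub>v (R *\<^sub>v \<dots>)"
    using a x Px by (intro mult_mat_vec[of _ "Suc V" "Suc V"] mv[of _ _ K]) auto
  finally show ?thesis unfolding smooth_coeff_def by simp
qed

text \<open>B1 = Phi^H B^T supplies the left factor that completes 1/N R B to Phi^H G, acting on the
  mismatch a - Phi x.\<close>

lemma B1_mat_smooth_coeff:
  fixes Ncp :: nat
  assumes KN: "K \<le> N" and a: "a \<in> carrier_vec K" and x: "x \<in> carrier_vec K"
  defines "E \<equiv> mat_adjoint (Phi_mat K N Ncp) * smoothing_proj K N V"
  shows "B1_mat K N Ncp V *\<^sub>v smooth_coeff K N Ncp V (ofdm_symbol K N a) x =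
    E *\<^sub>v a + (- (E * Phi_mat K N Ncp)) *\<^sub>v x"
proof -
  note [simp] = carriers
  note mv = mult_mat_vec_carrier
  let ?Phi = "Phi_mat K N Ncp" and ?G = "smoothing_proj K N V"
  define u where "u = a - ?Phi *\<^sub>v x"
  have Px: "?Phi *\<^sub>v x \<in> carrier_vec K" using x by (intro mv[of _ K K]) auto
  then have u: "u \<in> carrier_vec K" using a by (simp add: u_def)
  have Bu: "B *\<^sub>v u \<in> carrier_vec (Suc V)" using u by (intro mv[of _ _ K]) auto
  have RBu: "R *\<^sub>v (B *\<^sub>v u) \<in> carrier_vec (Suc V)" by (rule mv[OF carriers(3) Bu])
  have E: "E \<in> carrier_mat K K"
    unfolding E_def using smoothing_proj_carrier by (intro mult_carrier_mat[of _ K K]) auto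
  have "?G *\<^sub>v u = (1 / of_nat N) \<cdot>\<^sub>v ((T * (R * B)) *\<^sub>v u)"
    unfolding smoothing_proj_def using u by (intro smult_mat_mult_vec[of _ K K]) auto
  also have "(T * (R * B)) *\<^sub>v u = T *\<^sub>v ((R * B) *\<^sub>v u)"
    using u by (intro assoc_mult_mat_vec[of _ K "Suc V" _ K]) auto
  also have "(R * B) *\<^sub>v u = R *\<^sub>v (B *\<^sub>v u)"
    using u by (intro assoc_mult_mat_vec[of _ "Suc V" "Suc V" _ K]) auto
  finally have Gu: "?G *\<^sub>v u = (1 / of_nat N) \<cdot>\<^sub>v (T *\<^sub>v (R *\<^sub>v (B *\<^sub>v u)))" .
  have "B1_mat K N Ncp V *\<^sub>v smooth_coeff K N Ncp V (ofdm_symbol K N a) x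
      = (1 / of_nat N) \<cdot>\<^sub>v (B1_mat K N Ncp V *\<^sub>v (R *\<^sub>v (B *\<^sub>v u)))"
    unfolding smooth_coeff_ofdm_symbol[OF KN a x] u_def[symmetric]
    by (rule mult_mat_vec[OF B1_mat_carrier RBu])
  also have "B1_mat K N Ncp V *\<^sub>v (R *\<^sub>v (B *\<^sub>v u)) = mat_adjoint ?Phi *\<^sub>v (T *\<^sub>v (R *\<^sub>v (B *\<^sub>v u)))"
    unfolding B1_mat_def using RBu by (intro assoc_mult_mat_vec[of _ K K _ "Suc V"]) auto
  also have "(1 / of_nat N) \<cdot>\<^sub>v \<dots> = mat_adjoint ?Phi *\<^sub>v (?G *\<^sub>v u)"
    unfolding Gu by (rule mult_mat_vec[symmetric, of _ K K]) (simp, rule mv[OF carriers(2) RBu])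
  also have "\<dots> = E *\<^sub>v u"
    unfolding E_def using u smoothing_proj_carrier
    by (intro assoc_mult_mat_vec[symmetric, of _ K K _ K]) auto
  also have "\<dots> = E *\<^sub>v a - E *\<^sub>v (?Phi *\<^sub>v x)"
    unfolding u_def using E a Px by (intro mult_minus_distrib_mat_vec) auto
  also have "E *\<^sub>v (?Phi *\<^sub>v x) = (E * ?Phi) *\<^sub>v x"
    using E x by (intro assoc_mult_mat_vec[symmetric, of _ K K _ K]) auto
  \<comment> \<open>The sign goes into the matrix to reach the form A X + B Y of
    \<open>cross_corr_lin_comb_self\<close>.\<close>
  also have "E *\<^sub>v a - (E * ?Phi) *\<^sub>v x = E *\<^sub>v a + (- (E * ?Phi)) *\<^sub>v x"
    using E x a carrier_matD[OF Phi_mat_carrier[of K N Ncp]] by (intro eq_vecI) auto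
  finally show ?thesis .
qed

end

lemma ofdm_symbol_add:
  assumes "a \<in> carrier_vec K" "b \<in> carrier_vec K"
  shows "ofdm_symbol K N (a + b) = ofdm_symbol K N a + ofdm_symbol K N b"
proof -
  have "mat_adjoint (Fourier_mat K N) *\<^sub>v (a + b)
      = mat_adjoint (Fourier_mat K N) *\<^sub>v a + mat_adjoint (Fourier_mat K N) *\<^sub>v b"
    using assms by (intro mult_add_distrib_mat_vec[of _ N K]) auto
  then show ?thesis
    unfolding ofdm_symbol_def using assms
    by (simp add: smult_add_distrib_vec[of _ N] mult_mat_vec_carrier[of _ N K])
qed

text \<open>The smooth signal is itself an OFDM symbol, with spectrum B1 b, so all powers can be
  computed on spectra.\<close>

lemma Qf_mat_mult_vec:
  assumes "b \<in> carrier_vec (Suc V)"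
  shows "Qf_mat K N Ncp V *\<^sub>v b = ofdm_symbol K N (B1_mat K N Ncp V *\<^sub>v b)"
proof -
  note B1 = B1_mat_carrier[of K N Ncp V]
  have "Qf_mat K N Ncp V *\<^sub>v b
      = (1 / of_nat N) \<cdot>\<^sub>v ((mat_adjoint (Fourier_mat K N) * B1_mat K N Ncp V) *\<^sub>v b)"
    unfolding Qf_mat_def using assms B1
    by (intro smult_mat_mult_vec[of _ N "Suc V"] mult_carrier_mat[of _ N K]) auto
  also have "(mat_adjoint (Fourier_mat K N) * B1_mat K N Ncp V) *\<^sub>v b
      = mat_adjoint (Fourier_mat K N) *\<^sub>v (B1_mat K N Ncp V *\<^sub>v b)"
    using assms B1 by (intro assoc_mult_mat_vec[of _ N K _ "Suc V"]) auto
  finally show ?thesis by (simp add: ofdm_symbol_def)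
qed

text \<open>Two factors 1/N from the symbol meet one factor N from F F^H.\<close>

lemma ofdm_symbol_power:
  assumes "0 < N" "K \<le> N" and a: "a \<in> carrier_vec K"
  shows "conjugate (ofdm_symbol K N a) \<bullet> ofdm_symbol K N a = 1 / of_nat N * (conjugate a \<bullet> a)"
proof -
  let ?F = "Fourier_mat K N"
  define z where "z = mat_adjoint ?F *\<^sub>v a"
  have z: "z \<in> carrier_vec N" unfolding z_def using a by (intro mult_mat_vec_carrier[of _ N K]) auto
  have "?F *\<^sub>v z = (?F * mat_adjoint ?F) *\<^sub>v a"
    unfolding z_def using a by (intro assoc_mult_mat_vec[symmetric, of _ K N _ K]) auto
  also have "\<dots> = of_nat N \<cdot>\<^sub>v a"
    unfolding Fourier_mat_mult_adjoint[OF assms(1,2)] using a by (simp add: smult_mat_mult_vec[of _ K K])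
  finally have Fz: "?F *\<^sub>v z = of_nat N \<cdot>\<^sub>v a" .
  have "conjugate z \<bullet> z = conjugate a \<bullet> (?F *\<^sub>v z)"
    using conjugate_scalar_prod_mult_mat_vec[of ?F K N a z] a z by (simp add: z_def)
  also have "\<dots> = of_nat N * (conjugate a \<bullet> a)"
    unfolding Fz using a by simp
  finally have zz: "conjugate z \<bullet> z = of_nat N * (conjugate a \<bullet> a)" .
  have "conjugate ((1 / of_nat N) \<cdot>\<^sub>v z) \<bullet> ((1 / of_nat N) \<cdot>\<^sub>v z)
      = (1 / of_nat N) * (1 / of_nat N) * (conjugate z \<bullet> z)"
    using z by (simp add: conjugate_smult_vec)
  then show ?thesis
    unfolding zz ofdm_symbol_def z_def[symmetric] using assms(1) by simp
qed

lemma avg_power_ofdm_symbol: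
  assumes "0 < N" "K \<le> N" "\<And>\<omega>. Z \<omega> \<in> carrier_vec K"
  shows "avg_power M (\<lambda>\<omega>. ofdm_symbol K N (Z \<omega>)) = 1 / of_nat N * avg_power M Z"
  unfolding avg_power_def ofdm_symbol_power[OF assms] by (rule integral_mult_right_zero)

text \<open>\<open>smoothed_spectrum\<close> is defined through \<open>b_vec\<close>, which refers
  back to the time-domain symbol. The first claim closes this loop: it lets
  \<open>B1_mat_smooth_coeff\<close> act on the previous smoothed symbol, which yields the other
  two.\<close>

lemma
  fixes Ncp :: nat
  assumes KN: "0 < N" "K \<le> N" and VK: "V + 1 \<le> K" and x: "\<And>k. x k \<in> carrier_vec K"
  defines "E \<equiv> mat_adjoint (Phi_mat K N Ncp) * smoothing_proj K N V"
  shows smoothed_symbol_eq_ofdm_symbol: "smoothed_spectrum K N Ncp V x i \<in> carrier_vec K \<and>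
    smoothed_symbol K N Ncp V x i = ofdm_symbol K N (smoothed_spectrum K N Ncp V x i)"
    (is "?A i \<in> _ \<and> _")
    and smooth_signal_Suc: "smooth_signal K N Ncp V x (Suc i) = ofdm_symbol K N
      (E *\<^sub>v smoothed_spectrum K N Ncp V x i + (- (E * Phi_mat K N Ncp)) *\<^sub>v x (Suc i))"
    (is "?signal i")
    and smoothed_spectrum_Suc: "smoothed_spectrum K N Ncp V x (Suc i) =
      E *\<^sub>v smoothed_spectrum K N Ncp V x i + (1\<^sub>m K - E * Phi_mat K N Ncp) *\<^sub>v x (Suc i)"
    (is "?spectrum i")
proof -
  let ?J = "E * Phi_mat K N Ncp"
  have E: "E \<in> carrier_mat K K"
    unfolding E_def using smoothing_proj_carrier[OF KN(1) VK] by (intro mult_carrier_mat[of _ K K]) auto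
  then have J: "?J \<in> carrier_mat K K" by (intro mult_carrier_mat) auto
  have B1: "B1_mat K N Ncp V \<in> carrier_mat K (Suc V)" by (rule B1_mat_carrier)
  have coeff: "smooth_coeff K N Ncp V y a \<in> carrier_vec (Suc V)" for y a
    unfolding smooth_coeff_def P2_mat_def
    using Pf_inv(1)[OF KN(1) VK] by (intro carrier_vecI) (auto simp: B2_mat_def)
  have step: "?A i \<in> carrier_vec K \<Longrightarrow> smoothed_symbol K N Ncp V x i = ofdm_symbol K N (?A i) \<Longrightarrow>
      B1_mat K N Ncp V *\<^sub>v b_vec K N Ncp V x (Suc i) = E *\<^sub>v ?A i + (- ?J) *\<^sub>v x (Suc i)" for i
    unfolding b_vec_def E_def by (simp add: B1_mat_smooth_coeff[OF KN(1) VK KN(2) _ x])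
  have main: "?A i \<in> carrier_vec K \<and> smoothed_symbol K N Ncp V x i = ofdm_symbol K N (?A i)" for i
  proof (induction i)
    case 0
    then show ?case using x by (simp add: smoothed_spectrum_def)
  next
    case (Suc i)
    have "B1_mat K N Ncp V *\<^sub>v b_vec K N Ncp V x (Suc i) \<in> carrier_vec K"
      using B1 coeff by (auto simp: b_vec_def)
    moreover have "Qf_mat K N Ncp V *\<^sub>v b_vec K N Ncp V x (Suc i) =
        ofdm_symbol K N (B1_mat K N Ncp V *\<^sub>v b_vec K N Ncp V x (Suc i))"
      by (rule Qf_mat_mult_vec) (simp add: b_vec_def coeff)
    ultimately show ?case
      using x by (simp add: smoothed_spectrum_def ofdm_symbol_add b_vec_def)
  qed
  then show "?A i \<in> carrier_vec K \<and> smoothed_symbol K N Ncp V x i = ofdm_symbol K N (?A i)" .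
  have W: "B1_mat K N Ncp V *\<^sub>v b_vec K N Ncp V x (Suc i) = E *\<^sub>v ?A i + (- ?J) *\<^sub>v x (Suc i)"
    using main by (intro step) auto
  show "?signal i"
    unfolding smooth_signal_def W[symmetric]
    by (rule Qf_mat_mult_vec) (simp add: b_vec_def coeff)
  have "?A (Suc i) = x (Suc i) + (E *\<^sub>v ?A i + (- ?J) *\<^sub>v x (Suc i))"
    by (simp add: smoothed_spectrum_def W)
  also have "\<dots> = E *\<^sub>v ?A i + (x (Suc i) - ?J *\<^sub>v x (Suc i))"
    using E J x[of "Suc i"] main[of i] carrier_matD[OF Phi_mat_carrier[of K N Ncp]]
    by (intro eq_vecI) auto
  also have "x (Suc i) - ?J *\<^sub>v x (Suc i) = (1\<^sub>m K - ?J) *\<^sub>v x (Suc i)"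
    using J x[of "Suc i"] by (subst minus_mult_distrib_mat_vec[of _ K K]) auto
  finally show "?spectrum i" .
qed

section \<open>The rotated projection, whiteness and the average powers\<close>

text \<open>Phi is unitary, so J inherits idempotence, symmetry and trace from G. In E E^H the two
  copies of G meet and merge into one, which gives J.\<close>

lemma
  fixes Ncp :: nat
  assumes "0 < N" and "V + 1 \<le> K"
  defines "E \<equiv> mat_adjoint (Phi_mat K N Ncp) * smoothing_proj K N V"
  defines "J \<equiv> E * Phi_mat K N Ncp"
  shows rotated_proj_carrier: "E \<in> carrier_mat K K" "J \<in> carrier_mat K K"
    and rotated_proj_mult_adjoint: "E * mat_adjoint E = J"
    and rotated_proj_idem: "J * J = J"
    and mat_adjoint_rotated_proj: "mat_adjoint J = J"
    and mat_trace_rotated_proj: "mat_trace J = of_nat (V + 1)"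
proof -
  let ?Phi = "Phi_mat K N Ncp" and ?G = "smoothing_proj K N V"
  note [simp] = smoothing_proj_carrier[OF assms(1,2)]
  note assoc = assoc_mult_mat[of _ K K _ K _ K] and mc = mult_carrier_mat[of _ K K _ K]
  show E: "E \<in> carrier_mat K K" by (simp add: E_def mc)
  then show "J \<in> carrier_mat K K" by (simp add: J_def mc)
  have GG: "?G * (?G * A) = ?G * A" if "A \<in> carrier_mat K K" for A
    using that assoc[of ?G ?G A] by (simp add: smoothing_proj_idem[OF assms(1,2)])
  have PP: "?Phi * (mat_adjoint ?Phi * A) = A" if "A \<in> carrier_mat K K" for A
    using that assoc[of ?Phi "mat_adjoint ?Phi" A]
    by (simp add: Phi_mat_mult_adjoint left_mult_one_mat[of _ K K])
  have adjE: "mat_adjoint E = ?G * ?Phi"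
    by (simp add: E_def mat_adjoint_mult[of _ K K _ K] mat_adjoint_smoothing_proj[OF assms(1,2)])
  show EE: "E * mat_adjoint E = J"
    unfolding adjE by (simp add: J_def E_def assoc mc GG)
  show "J * J = J"
    by (simp add: J_def E_def assoc mc GG PP)
  show "mat_adjoint J = J"
    unfolding EE[symmetric] using E by (simp add: mat_adjoint_mult[of _ K K _ K])
  have "mat_trace J = mat_trace (?Phi * E)"
    unfolding J_def by (rule mat_trace_comm[OF E]) simp
  then show "mat_trace J = of_nat (V + 1)"
    by (simp add: E_def PP mat_trace_smoothing_proj[OF assms(1,2)])
qed

text \<open>The covariance J injected by the past fills exactly the directions that I - J removes
  from the new data. The last clause covers all l > i because the next step needs it for the
  following data vector and must also pass it on.\<close>

lemma smoothed_spectrum_white: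
  fixes Ncp :: nat
  assumes KN: "0 < N" "K \<le> N" and VK: "V + 1 \<le> K" and unc: "uncorrelated_data M K X"
  defines "A \<equiv> \<lambda>i \<omega>. smoothed_spectrum K N Ncp V (\<lambda>k. X k \<omega>) i"
  shows "square_integrable_vec M K (A i) \<and> cross_corr M K (A i) (A i) = 1\<^sub>m K \<and>
    (\<forall>l>i. cross_corr M K (A i) (X l) = 0\<^sub>m K K)"
proof (induction i)
  case 0
  have "A 0 = X 0" by (simp add: A_def smoothed_spectrum_def)
  then show ?case
    using unc uncorrelated_data_square_integrable[OF unc] by (auto simp: uncorrelated_data_def)
next
  case (Suc i)
  define E where "E = mat_adjoint (Phi_mat K N Ncp) * smoothing_proj K N V"
  define J where "J = E * Phi_mat K N Ncp"
  have E: "E \<in> carrier_mat K K" and J: "J \<in> carrier_mat K K"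
    and EE: "E * mat_adjoint E = J" and JJ: "J * J = J" and adjJ: "mat_adjoint J = J"
    unfolding E_def J_def
    by (rule rotated_proj_carrier rotated_proj_mult_adjoint rotated_proj_idem
        mat_adjoint_rotated_proj; fact KN VK)+
  note sqX = uncorrelated_data_square_integrable[OF unc]
  have H: "1\<^sub>m K - J \<in> carrier_mat K K" using J by (intro minus_carrier_mat)
  have A: "A (Suc i) = (\<lambda>\<omega>. E *\<^sub>v A i \<omega> + (1\<^sub>m K - J) *\<^sub>v X (Suc i) \<omega>)"
    unfolding A_def E_def J_def
    by (intro ext smoothed_spectrum_Suc[OF KN VK] square_integrable_vec_carrier[OF sqX])
  have sq: "square_integrable_vec M K (A (Suc i))"
    unfolding A using E H Suc sqX by (intro square_integrable_vec_add square_integrable_vec_mult) auto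
  \<comment> \<open>The complement of an orthogonal projection is again one, so it equals its own
    covariance.\<close>
  have "(1\<^sub>m K - J) * mat_adjoint (1\<^sub>m K - J) = (1\<^sub>m K - J) * 1\<^sub>m K - (1\<^sub>m K - J) * J"
    using J H by (simp add: mat_adjoint_minus[of _ K K] adjJ mult_minus_distrib_mat[of _ K K _ K])
  also have "\<dots> = 1\<^sub>m K - J"
    using J H by (simp add: minus_mult_distrib_mat[of _ K K _ _ K] JJ) (intro eq_matI; auto)
  finally have HH: "(1\<^sub>m K - J) * mat_adjoint (1\<^sub>m K - J) = 1\<^sub>m K - J" .
  have "cross_corr M K (A (Suc i)) (A (Suc i)) = E * mat_adjoint E + (1\<^sub>m K - J) * mat_adjoint (1\<^sub>m K - J)"
    unfolding A using Suc sqX E H unc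
    by (intro cross_corr_lin_comb_self) (auto simp: uncorrelated_data_def)
  also have "\<dots> = 1\<^sub>m K"
    unfolding EE HH using J by (intro eq_matI) auto
  finally have "cross_corr M K (A (Suc i)) (A (Suc i)) = 1\<^sub>m K" .
  moreover have "cross_corr M K (A (Suc i)) (X l) = 0\<^sub>m K K" if "l > Suc i" for l
  proof -
    have "cross_corr M K (A (Suc i)) (X l)
        = E * cross_corr M K (A i) (X l) + (1\<^sub>m K - J) * cross_corr M K (X (Suc i)) (X l)"
      unfolding A using Suc sqX E H by (intro cross_corr_lin_comb_left) auto
    also have "\<dots> = 0\<^sub>m K K"
      using Suc that unc E H by (simp add: uncorrelated_data_def right_mult_zero_mat[of _ K K])
    finally show ?thesis .
  qed
  ultimately show ?case using sq by blast
qed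

lemma avg_power_smooth_signal:
  assumes KN: "0 < N" "K \<le> N" and VK: "V + 1 \<le> K" and unc: "uncorrelated_data M K X"
  shows "avg_power M (\<lambda>\<omega>. smooth_signal K N Ncp V (\<lambda>k. X k \<omega>) (Suc i))
    = complex_of_real (2 * (real V + 1) / real N)"
proof -
  define A where "A \<omega> = smoothed_spectrum K N Ncp V (\<lambda>k. X k \<omega>) i" for \<omega>
  define E where "E = mat_adjoint (Phi_mat K N Ncp) * smoothing_proj K N V"
  define J where "J = E * Phi_mat K N Ncp"
  have E: "E \<in> carrier_mat K K" and J: "J \<in> carrier_mat K K"
    and EE: "E * mat_adjoint E = J" and JJ: "J * J = J" and adjJ: "mat_adjoint J = J"
    and trJ: "mat_trace J = of_nat (V + 1)"
    unfolding E_def J_def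
    by (rule rotated_proj_carrier rotated_proj_mult_adjoint rotated_proj_idem
        mat_adjoint_rotated_proj mat_trace_rotated_proj; fact KN VK)+
  note sqX = uncorrelated_data_square_integrable[OF unc]
  have sqA: "square_integrable_vec M K A" and AA: "cross_corr M K A A = 1\<^sub>m K"
    and AX: "cross_corr M K A (X (Suc i)) = 0\<^sub>m K K"
    unfolding A_def using smoothed_spectrum_white[OF KN VK unc] by auto
  define W where "W \<omega> = E *\<^sub>v A \<omega> + (- J) *\<^sub>v X (Suc i) \<omega>" for \<omega>
  have sqW: "square_integrable_vec M K W"
    unfolding W_def using sqA sqX E J by (intro square_integrable_vec_add square_integrable_vec_mult) auto
  have "(\<lambda>\<omega>. smooth_signal K N Ncp V (\<lambda>k. X k \<omega>) (Suc i)) = (\<lambda>\<omega>. ofdm_symbol K N (W \<omega>))"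
    unfolding A_def W_def E_def J_def
    by (intro ext smooth_signal_Suc[OF KN VK] square_integrable_vec_carrier[OF sqX])
  then have "avg_power M (\<lambda>\<omega>. smooth_signal K N Ncp V (\<lambda>k. X k \<omega>) (Suc i))
      = 1 / of_nat N * mat_trace (cross_corr M K W W)"
    using avg_power_ofdm_symbol[OF KN square_integrable_vec_carrier[OF sqW], of M "\<lambda>\<omega>. \<omega>"]
      avg_power_eq_mat_trace[OF sqW] by simp
  also have "cross_corr M K W W = E * mat_adjoint E + (- J) * mat_adjoint (- J)"
    unfolding W_def using sqA sqX AA AX E J unc
    by (intro cross_corr_lin_comb_self) (auto simp: uncorrelated_data_def)
  \<comment> \<open>The current data contribute the same covariance J as the previous symbol does
    through \<open>EE\<close>.\<close>
  also have "(- J) * mat_adjoint (- J) = J"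
    using J by (simp add: mat_adjoint_uminus adjJ JJ)
  finally show ?thesis
    using J by (simp add: EE mat_trace_add[of _ K] trJ)
qed

lemma avg_power_ofdm_data:
  assumes "0 < N" "K \<le> N" and unc: "uncorrelated_data M K X"
  shows "avg_power M (\<lambda>\<omega>. ofdm_symbol K N (X i \<omega>)) = complex_of_real (real K / real N)"
proof -
  note sqX = uncorrelated_data_square_integrable[OF unc]
  show ?thesis
    unfolding avg_power_ofdm_symbol[OF assms(1,2) square_integrable_vec_carrier[OF sqX]]
      avg_power_eq_mat_trace[OF sqX]
    using unc by (simp add: uncorrelated_data_def mat_trace_one)
qed

section \<open>Power ratio and SINR\<close>

theorem mainTheorem2:
  fixes M :: "'w measure"
    and X :: "nat \<Rightarrow> 'w \<Rightarrow> complex vec"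
    and K N Ncp V :: nat
  assumes "prob_space M"
    and "even K"
    and "K \<le> N"
    and "V + 1 \<le> K"
    and "uncorrelated_data M K X"
  defines "y \<equiv> \<lambda>i \<omega>. ofdm_symbol K N (X i \<omega>)"
    and "w \<equiv> \<lambda>i \<omega>. smooth_signal K N Ncp V (\<lambda>k. X k \<omega>) i"
  shows "(\<forall>i. avg_power M (y i) = complex_of_real (real K / real N)) \<and>
    (\<forall>i>0. avg_power M (w i) = complex_of_real (2 * (real V + 1) / real N)) \<and>
    (\<forall>i>0. avg_power M (y i) / avg_power M (w i) =
       complex_of_real (real K / (2 * (real V + 1)))) \<and>
    (\<forall>L h tau s2 n r. multipath_channel M K N Ncp V X L h tau s2 n r \<longrightarrow>
       (\<forall>l\<in>{1..L}. tau l \<le> real Ncp) \<longrightarrow>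
       (\<forall>i>0. sinr M L h s2 (y i) (w i) =
          complex_of_real ((real K / real N) /
            (s2 / (\<Sum>l=1..L. (cmod (h l))\<^sup>2) + 2 * (real V + 1) / real N))))"
proof -
  have N: "0 < N" using assms(3,4) by simp
  have y: "avg_power M (y i) = complex_of_real (real K / real N)" for i
    unfolding y_def by (rule avg_power_ofdm_data[OF N assms(3,5)])
  have w: "avg_power M (w i) = complex_of_real (2 * (real V + 1) / real N)" if "i > 0" for i
    using avg_power_smooth_signal[OF N assms(3-5), of Ncp "i - 1"] that by (simp add: w_def)
  have "avg_power M (y i) / avg_power M (w i) = complex_of_real (real K / (2 * (real V + 1)))" if "i > 0" for i
    unfolding y w[OF that] of_real_divide[symmetric] using N by (simp add: divide_simps)
  moreover have "sinr M L h s2 (y i) (w i) = complex_of_real ((real K / real N) /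
      (s2 / (\<Sum>l=1..L. (cmod (h l))\<^sup>2) + 2 * (real V + 1) / real N))"
    if chan: "multipath_channel M K N Ncp V X L h tau s2 n r" and "i > 0" for L h tau s2 n r i
  proof -
    define g where "g = (\<Sum>l=1..L. (cmod (h l))\<^sup>2)"
    obtain l where "l \<in> {1..L}" "h l \<noteq> 0"
      using chan by (auto simp: multipath_channel_def)
    \<comment> \<open>One nonzero path makes the total gain positive, so it can be divided out of
      numerator and denominator.\<close>
    then have g: "g > 0"
      unfolding g_def by (intro sum_pos2[of _ l]) auto
    have "sinr M L h s2 (y i) (w i) = complex_of_real (g * (real K / real N) /
        (s2 + g * (2 * (real V + 1) / real N)))"
      unfolding sinr_def y w[OF \<open>i > 0\<close>] g_def sum_distrib_right
      by (simp only: of_real_mult of_real_divide of_real_add of_real_sum)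
    also have "g * (real K / real N) / (s2 + g * (2 * (real V + 1) / real N)) =
        (real K / real N) / (s2 / g + 2 * (real V + 1) / real N)"
    proof -
      have "s2 + g * (2 * (real V + 1) / real N) = g * (s2 / g + 2 * (real V + 1) / real N)"
        using g by (simp add: distrib_left)
      then show ?thesis using g by simp
    qed
    finally show ?thesis unfolding g_def .
  qed
  ultimately show ?thesis using y w by blast
qed

end
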